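(* Let $A\subset\mathbb{R}$ be a Borel set and let $F:\mathbb{H}^+\to\mathbb{H}^+$ be an analytic function. Then the following statements are equivalent: 1) $F\in\mathcal{N}(A)$; 2) the function $$G(z):=\frac{1}{1+z^2}\,\Big[\Re\big(F(i)\big)+\Im\big(F(i)\big)\,z-F(z)\Big],\qquad z\in\mathbb{H}^+,$$ is the Cauchy transform of a finite measure on $A$; 3) the function $H(w):=\dfrac{iF(iw)}{w^2-1}$, $w>1$, is of the form $$H(w)=\mathfrak{L}\Big[\mathfrak{F}[\rho\,;\,s]+i\,\Re\big(F(i)\big)\sinh(s)-\Im\big(F(i)\big)\cosh(s)\,;\,w\Big],\qquad w>1,$$ for some finite measure $\rho$ on $A$. In particular, $F\in\mathcal{N}(\mathbb{R}_+)$ if, and only if, the function $G$ has a continuous extension $G:(0,\infty)\to\mathbb{R}_+$ which is the Stieltjes transform of some finite measure on $\mathbb{R}_+$.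
   Context: $\mathbb{H}^+=\{z\in\mathbb{C}:\Im(z)>0\}$ and $\mathbb{R}_+=[0,\infty)$. All measures are non-negative Borel measures. The class $\mathcal{N}$ of Nevanlinna-Pick functions consists of the functions of the form $$F(z)=a+bz+\int_{\mathbb{R}}\frac{zx-1}{z+x}\,\rho(dx),$$ with $a\in\mathbb{R}$, $b\ge 0$ and $\rho$ a finite measure on $\mathbb{R}$ (these are uniquely determined by $F$). A function given on $\mathbb{H}^+$ is extended to $\mathbb{C}\setminus\mathbb{R}$ by $F(z)=\overline{F(\overline z)}$. For a Borel set $A\subset\mathbb{R}$, $\mathcal{N}(A)$ is the set of $F\in\mathcal{N}$ whose measure $\rho$ is supported (i.e. concentrated) on $A$. A Cauchy transform of a finite measure $\mu$ is a function of the form $z\mapsto c+\int_{\mathbb{R}}\frac{1}{z+x}\,\mu(dx)$ with $c\in\mathbb{R}$. A Stieltjes transform of a finite measure $\mu$ on $\mathbb{R}_+$ is a function of the form $\lambda\mapsto d+\int_{[0,\infty)}\frac{1}{\lambda+u}\,\mu(du)$, $\lambda>0$, with $d\ge 0$. The value of $G$ at $z=i$ (a removable singularity) is defined by continuity. $\mathfrak{F}[\rho\,;\,s]=\int_{\mathbb{R}}e^{isx}\rho(dx)$ is the Fourier transform, and $\mathfrak{L}[f(s)\,;\,w]=\int_0^\infty e^{-ws}f(s)\,ds$ is the Laplace transform. *)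

theory Defs
  imports "HOL-Probability.Probability"
begin

definition upper_half_plane :: "complex set" where
  "upper_half_plane = {z. Im z > 0}"

text \<open>A measure on a Borel set \<open>A\<close> is represented by a Borel measure on the whole
  line whose mass outside \<open>A\<close> is zero (\<open>A\<close> need not be closed).\<close>

definition finite_measure_on :: "real set \<Rightarrow> real measure \<Rightarrow> bool" where
  "finite_measure_on A \<rho> \<longleftrightarrow> finite_borel_measure \<rho> \<and> emeasure \<rho> (UNIV - A) = 0"

text \<open>Nevanlinna-Pick functions are regarded as functions on the upper half plane: values
  of the total function \<open>F\<close> elsewhere are irrelevant.\<close>

definition nevanlinna_rep :: "real \<Rightarrow> real \<Rightarrow> real measure \<Rightarrow> (complex \<Rightarrow> complex) \<Rightarrow> bool" where
  "nevanlinna_rep a b \<rho> F \<longleftrightarrow>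
     b \<ge> 0 \<and> finite_borel_measure \<rho> \<and>
     (\<forall>z\<in>upper_half_plane.
        F z = of_real a + of_real b * z + (CLINT x|\<rho>. (z * of_real x - 1) / (z + of_real x)))"

definition nevanlinna :: "(complex \<Rightarrow> complex) set" where
  "nevanlinna = {F. \<exists>a b \<rho>. nevanlinna_rep a b \<rho> F}"

text \<open>The triple \<open>(a, b, \<rho>)\<close> is determined by \<open>F\<close>, so the existential
  quantifier below speaks about the representing measure of \<open>F\<close>.\<close>

definition nevanlinna_on :: "real set \<Rightarrow> (complex \<Rightarrow> complex) set" where
  "nevanlinna_on A = {F \<in> nevanlinna. \<exists>a b \<rho>. nevanlinna_rep a b \<rho> F \<and> finite_measure_on A \<rho>}"

definition is_cauchy_transform :: "(complex \<Rightarrow> complex) \<Rightarrow> real measure \<Rightarrow> bool" where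
  "is_cauchy_transform g \<mu> \<longleftrightarrow>
     (\<exists>c::real. \<forall>z\<in>upper_half_plane. g z = of_real c + (CLINT x|\<mu>. 1 / (z + of_real x)))"

definition is_stieltjes_transform :: "(real \<Rightarrow> real) \<Rightarrow> real measure \<Rightarrow> bool" where
  "is_stieltjes_transform g \<mu> \<longleftrightarrow>
     (\<exists>d\<ge>0. \<forall>t>0. g t = d + (LINT u:{0..}|\<mu>. 1 / (t + u)))"

definition laplace_transform :: "(real \<Rightarrow> complex) \<Rightarrow> real \<Rightarrow> complex" where
  "laplace_transform f w = (CLBINT s:{0..}. of_real (exp (- w * s)) * f s)"

definition G_raw :: "(complex \<Rightarrow> complex) \<Rightarrow> complex \<Rightarrow> complex" where
  "G_raw F z = 1 / (1 + z\<^sup>2) * (of_real (Re (F \<i>)) + of_real (Im (F \<i>)) * z - F z)"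

text \<open>The value at the removable singularity \<open>\<i>\<close> is the limit there.\<close>

definition G_fun :: "(complex \<Rightarrow> complex) \<Rightarrow> complex \<Rightarrow> complex" where
  "G_fun F z = (if z = \<i> then Lim (at \<i>) (G_raw F) else G_raw F z)"

definition H_fun :: "(complex \<Rightarrow> complex) \<Rightarrow> real \<Rightarrow> complex" where
  "H_fun F w = \<i> * F (\<i> * of_real w) / of_real (w\<^sup>2 - 1)"

text \<open>\<open>g\<close> is a continuous extension of \<open>G\<close> from the upper half plane to the positive
  half line, with values in \<open>[0,\<infinity>)\<close> there; \<open>h\<close> is its restriction to the
  half line.\<close>

definition continuous_extension_to_pos ::
    "(complex \<Rightarrow> complex) \<Rightarrow> (complex \<Rightarrow> complex) \<Rightarrow> (real \<Rightarrow> real) \<Rightarrow> bool" where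
  "continuous_extension_to_pos G g h \<longleftrightarrow>
     continuous_on (upper_half_plane \<union> of_real ` {0<..}) g \<and>
     (\<forall>z\<in>upper_half_plane. g z = G z) \<and>
     (\<forall>t>0. g (of_real t) = of_real (h t) \<and> h t \<ge> 0)"

end

theory Submission
  imports Defs "HOL-Complex_Analysis.Complex_Analysis"
begin

text \<open>Everything rests on the partial fraction decomposition
\<open>(z * x - 1) / (z + x) = z - (1 + z\<^sup>2) / (z + x)\<close>. Integrating it turns the Nevanlinna
representation of \<open>F\<close> with measure \<open>\<rho>\<close> into
\<open>F z = Re (F \<i>) + Im (F \<i>) * z - (1 + z\<^sup>2) * cauchy \<rho> z\<close>, where \<open>cauchy \<rho>\<close> is the Cauchy
transform of \<open>\<rho>\<close>: at \<open>z = \<i>\<close> the last summand vanishes, so the affine part is determined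
by \<open>F \<i>\<close>. Each of the three statements says that \<open>F\<close> has this form
(\<open>cauchy_form\<close>) for a measure of the required kind.

The point of the Nevanlinna statement (\<open>nevanlinna_on_iff_cauchy_form\<close>) is that a function of
this form automatically has \<open>b = Im (F \<i>) - \<rho> \<real> \<ge> 0\<close>; this is read off from
\<open>Im (F (\<i> * y)) > 0\<close> as \<open>y\<close> tends to infinity. Likewise the additive constant \<open>c\<close> allowed in
a Cauchy transform is forced to be \<open>0\<close> (\<open>cauchy_form_constant_eq_0\<close>): it contributes
\<open>- c * z\<^sup>2\<close> to \<open>F\<close>, whose imaginary part has opposite signs on the rays through \<open>1 + \<i>\<close> and
\<open>\<i> - 1\<close> and dominates the remaining terms, which grow linearly.

For \<open>G\<close> the equivalence is division by \<open>1 + z\<^sup>2\<close> (\<open>cauchy_form_iff_G_fun\<close>).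
For \<open>H\<close>, the Laplace transform of the characteristic function of \<open>\<rho>\<close> at \<open>w\<close> is
\<open>\<i> * cauchy \<rho> (\<i> * w)\<close> by Fubini, and \<open>sinh\<close> and \<open>cosh\<close> yield the affine part; so the
third statement is \<open>cauchy_form\<close> restricted to the half-line \<open>\<i> * w\<close>, \<open>w > 1\<close>, and the
identity theorem extends it to the half plane (\<open>cauchy_form_iff_H_fun\<close>).

For measures on the positive half-line, the Stieltjes transform is the restriction of the Cauchy
transform, which is holomorphic across the positive axis. If the continuous extension of \<open>G\<close>
agrees with it there, then the difference of the two, continued by zero into the
fourth quadrant, is holomorphic in the right half plane, hence zero
(\<open>stieltjes_extension_imp_cauchy_form\<close>).\<close>

section \<open>Cauchy transforms of finite measures\<close>

definition cauchy :: "real measure \<Rightarrow> complex \<Rightarrow> complex" where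
  "cauchy \<mu> z = (CLINT x|\<mu>. 1 / (z + of_real x))"

lemma finite_borel_measure_measurable:
  assumes "finite_borel_measure \<mu>"
  shows "borel_measurable \<mu> = borel_measurable borel"
  using finite_borel_measure.M_is_borel[OF assms] by (rule measurable_cong_sets) simp

lemma finite_borel_measure_space:
  assumes "finite_borel_measure \<mu>"
  shows "space \<mu> = UNIV"
  using finite_borel_measure.M_is_borel[OF assms] sets_eq_imp_space_eq by force

lemma cauchy_kernel_integrable:
  assumes \<mu>: "finite_borel_measure \<mu>" and "0 < \<delta>"
    and away: "AE x in \<mu>. \<delta> \<le> norm (z + of_real x)"
  shows "complex_integrable \<mu> (\<lambda>x. 1 / (z + of_real x))"
proof -
  interpret finite_borel_measure \<mu> by fact
  show ?thesis
  proof (rule integrable_const_bound)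
    show "AE x in \<mu>. norm (1 / (z + of_real x)) \<le> 1 / \<delta>"
      using away by eventually_elim (use \<open>0 < \<delta>\<close> in \<open>auto simp: norm_divide intro: frac_le\<close>)
    show "(\<lambda>x. 1 / (z + of_real x)) \<in> borel_measurable \<mu>"
      unfolding finite_borel_measure_measurable[OF \<mu>] by measurable
  qed
qed

lemma norm_cauchy_le:
  assumes \<mu>: "finite_borel_measure \<mu>" and "0 < \<delta>"
    and away: "AE x in \<mu>. \<delta> \<le> norm (z + of_real x)"
  shows "norm (cauchy \<mu> z) \<le> measure \<mu> UNIV / \<delta>"
proof -
  interpret finite_borel_measure \<mu> by fact
  have "norm (cauchy \<mu> z) \<le> (LINT x|\<mu>. 1 / \<delta>)"
    unfolding cauchy_def
  proof (intro order_trans[OF integral_norm_bound] integral_mono_AE)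
    show "AE x in \<mu>. norm (1 / (z + of_real x)) \<le> 1 / \<delta>"
      using away by eventually_elim (use \<open>0 < \<delta>\<close> in \<open>auto simp: norm_divide intro: frac_le\<close>)
  qed (use cauchy_kernel_integrable[OF assms] in \<open>auto intro!: integrable_norm simp del: norm_divide\<close>)
  then show ?thesis by (simp add: finite_borel_measure_space[OF \<mu>])
qed

text \<open>Differentiation under the integral sign. The kernel satisfies
\<open>(1 / p - 1 / q) / (p - q) + 1 / q\<^sup>2 = (p - q) / (p * q\<^sup>2)\<close>, which for \<open>\<bar>q\<bar> \<ge> \<delta>\<close> and
\<open>\<bar>p\<bar> \<ge> \<delta> / 2\<close> is \<open>O(p - q)\<close> uniformly in the integration variable. The distance to the
measure is only assumed almost everywhere, so that the lemma covers the upper half plane for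
arbitrary measures as well as the positive axis for measures on \<open>[0, \<infinity>)\<close>.\<close>

lemma cauchy_has_field_derivative:
  assumes \<mu>: "finite_borel_measure \<mu>" and "0 < \<delta>"
    and away: "AE x in \<mu>. \<delta> \<le> norm (z + of_real x)"
  shows "(cauchy \<mu> has_field_derivative - (CLINT x|\<mu>. 1 / (z + of_real x)\<^sup>2)) (at z)"
proof -
  interpret finite_borel_measure \<mu> by fact
  let ?D = "CLINT x|\<mu>. 1 / (z + of_real x)\<^sup>2"
  let ?K = "measure \<mu> UNIV * (2 / \<delta> ^ 3)"
  have D: "complex_integrable \<mu> (\<lambda>x. 1 / (z + of_real x)\<^sup>2)"
  proof (rule integrable_const_bound)
    show "AE x in \<mu>. norm (1 / (z + of_real x)\<^sup>2) \<le> 1 / \<delta>\<^sup>2"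
      using away
      by eventually_elim
        (use \<open>0 < \<delta>\<close> in \<open>auto simp: norm_divide norm_power intro!: frac_le power_mono\<close>)
    show "(\<lambda>x. 1 / (z + of_real x)\<^sup>2) \<in> borel_measurable \<mu>"
      unfolding finite_borel_measure_measurable[OF \<mu>] by measurable
  qed
  \<comment> \<open>Within \<open>\<delta> / 2\<close> of \<open>z\<close> the kernel of \<open>y\<close> still stays at distance \<open>\<delta> / 2\<close> from its pole.\<close>
  have bound: "norm ((cauchy \<mu> y - cauchy \<mu> z) / (y - z) + ?D) \<le> norm (y - z) * ?K"
    if y: "y \<noteq> z" "dist y z < \<delta> / 2" for y
  proof -
    have away_y: "AE x in \<mu>. \<delta> / 2 \<le> norm (y + of_real x)"
      using away
    proof eventually_elim
      case (elim x)
      have "norm (z + of_real x) \<le> norm (y + of_real x) + norm (z - y)"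
        using norm_triangle_ineq[of "y + of_real x" "z - y"] by (simp add: add.commute)
      with elim y(2) show ?case by (simp add: dist_norm norm_minus_commute)
    qed
    have int_y: "complex_integrable \<mu> (\<lambda>x. 1 / (y + of_real x))"
      using cauchy_kernel_integrable[OF \<mu> _ away_y] \<open>0 < \<delta>\<close> by simp
    have int_z: "complex_integrable \<mu> (\<lambda>x. 1 / (z + of_real x))"
      by (rule cauchy_kernel_integrable[OF assms])
    have eq: "(cauchy \<mu> y - cauchy \<mu> z) / (y - z) + ?D =
        (CLINT x|\<mu>. (1 / (y + of_real x) - 1 / (z + of_real x)) / (y - z) + 1 / (z + of_real x)\<^sup>2)"
      unfolding cauchy_def using int_y int_z D by simp
    have "norm \<dots> \<le> (LINT x|\<mu>. norm (y - z) * (2 / \<delta> ^ 3))"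
    proof (intro order_trans[OF integral_norm_bound] integral_mono_AE)
      show "AE x in \<mu>. norm ((1 / (y + of_real x) - 1 / (z + of_real x)) / (y - z)
              + 1 / (z + of_real x)\<^sup>2) \<le> norm (y - z) * (2 / \<delta> ^ 3)"
        using away away_y
      proof eventually_elim
        case (elim x)
        define p q where "p = y + of_real x" and "q = z + of_real x"
        have nz: "p \<noteq> 0" "q \<noteq> 0" using elim \<open>0 < \<delta>\<close> by (auto simp: p_def q_def)
        have "y - z = p - q" by (simp add: p_def q_def)
        have "(1 / p - 1 / q) / (p - q) + 1 / q\<^sup>2 = (p - q) / (p * q\<^sup>2)"
          using nz y(1) \<open>y - z = p - q\<close>
          by (cases "p = q") (simp_all add: divide_simps, simp add: power2_eq_square algebra_simps)
        moreover have "norm ((p - q) / (p * q\<^sup>2)) \<le> norm (p - q) * (2 / \<delta> ^ 3)"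
        proof -
          have "(\<delta> / 2) * \<delta>\<^sup>2 \<le> norm p * norm q ^ 2"
            using elim \<open>0 < \<delta>\<close> by (intro mult_mono power_mono) (auto simp: p_def q_def)
          then have "\<delta> ^ 3 / 2 \<le> norm (p * q\<^sup>2)"
            by (simp add: norm_mult norm_power power2_eq_square power3_eq_cube)
          then have "norm (p - q) / norm (p * q\<^sup>2) \<le> norm (p - q) / (\<delta> ^ 3 / 2)"
            using \<open>0 < \<delta>\<close> by (intro divide_left_mono mult_pos_pos) (use nz in auto)
          then show ?thesis by (simp add: norm_divide)
        qed
        ultimately show ?case by (simp add: p_def q_def)
      qed
    qed (use int_y int_z D \<open>0 < \<delta>\<close> in auto)
    then show ?thesis unfolding eq by (simp add: finite_borel_measure_space[OF \<mu>] mult_ac)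
  qed
  have "((\<lambda>y. (cauchy \<mu> y - cauchy \<mu> z) / (y - z) + ?D) \<longlongrightarrow> 0) (at z)"
  proof (rule Lim_null_comparison)
    show "\<forall>\<^sub>F y in at z. norm ((cauchy \<mu> y - cauchy \<mu> z) / (y - z) + ?D) \<le> norm (y - z) * ?K"
      unfolding eventually_at using bound \<open>0 < \<delta>\<close> by (intro exI[of _ "\<delta> / 2"]) auto
    show "((\<lambda>y. norm (y - z) * ?K) \<longlongrightarrow> 0) (at z)"
      by (rule tendsto_eq_intros refl | use \<open>0 < \<delta>\<close> in simp)+
  qed
  then show ?thesis
    unfolding has_field_derivative_iff by (simp add: LIM_zero_iff[of _ "- ?D", symmetric])
qed

lemma Im_le_norm_add_of_real: "Im z \<le> norm (z + of_real x)"
  using abs_Im_le_cmod[of "z + of_real x"] by simp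

lemma open_upper_half_plane: "open upper_half_plane"
  unfolding upper_half_plane_def by (rule open_halfspace_Im_gt)

lemma connected_upper_half_plane: "connected upper_half_plane"
  unfolding upper_half_plane_def by (rule convex_connected[OF convex_halfspace_Im_gt])

lemma cauchy_holomorphic_upper:
  assumes "finite_borel_measure \<mu>"
  shows "cauchy \<mu> holomorphic_on upper_half_plane"
proof -
  have "\<exists>D. (cauchy \<mu> has_field_derivative D) (at z)" if "z \<in> upper_half_plane" for z
    using cauchy_has_field_derivative[OF assms, of "Im z" z] that
    by (auto simp: upper_half_plane_def Im_le_norm_add_of_real)
  then show ?thesis
    by (simp add: holomorphic_on_open[OF open_upper_half_plane])
qed

lemma finite_measure_on_AE:
  assumes "finite_measure_on A \<mu>" "A \<in> sets borel"
  shows "AE x in \<mu>. x \<in> A"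
proof (rule AE_I')
  have s: "sets \<mu> = sets borel" "space \<mu> = UNIV"
    using assms finite_borel_measure.M_is_borel finite_borel_measure_space
    by (auto simp: finite_measure_on_def)
  show "UNIV - A \<in> null_sets \<mu>"
    using assms s by (auto simp: finite_measure_on_def null_sets_def)
  show "{x \<in> space \<mu>. x \<notin> A} \<subseteq> UNIV - A" by auto
qed

lemma cauchy_holomorphic_right:
  assumes \<mu>: "finite_measure_on {0..} \<mu>"
  shows "cauchy \<mu> holomorphic_on {z. 0 < Re z}"
proof -
  have "\<exists>D. (cauchy \<mu> has_field_derivative D) (at z)" if "0 < Re z" for z
  proof -
    have "AE x in \<mu>. Re z \<le> norm (z + of_real x)"
      using finite_measure_on_AE[OF \<mu> borel_closed[OF closed_atLeast]]
    proof eventually_elim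
      case (elim x)
      then show ?case using complex_Re_le_cmod[of "z + of_real x"] by simp
    qed
    with that \<mu> show ?thesis
      using cauchy_has_field_derivative[of \<mu> "Re z" z] by (auto simp: finite_measure_on_def)
  qed
  then show ?thesis
    by (simp add: holomorphic_on_open[OF open_halfspace_Re_gt])
qed

section \<open>The Nevanlinna representation in partial fractions\<close>

text \<open>The statement that \<open>G = c + cauchy \<mu>\<close>, multiplied by \<open>1 + z\<^sup>2\<close> and solved for \<open>F\<close>. In this form
the removable singularity at \<open>\<i>\<close> disappears: the equation at \<open>\<i>\<close> is trivial and both sides
are visibly holomorphic.\<close>
definition cauchy_form :: "(complex \<Rightarrow> complex) \<Rightarrow> real \<Rightarrow> real measure \<Rightarrow> bool" where
  "cauchy_form F c \<mu> \<longleftrightarrow> (\<forall>z\<in>upper_half_plane.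
     F z = of_real (Re (F \<i>)) + of_real (Im (F \<i>)) * z - (1 + z\<^sup>2) * (of_real c + cauchy \<mu> z))"

lemma cauchy_integrable_upper:
  assumes "finite_borel_measure \<mu>" "z \<in> upper_half_plane"
  shows "complex_integrable \<mu> (\<lambda>x. 1 / (z + of_real x))"
  using cauchy_kernel_integrable[OF assms(1), of "Im z" z] assms(2)
  by (simp add: upper_half_plane_def Im_le_norm_add_of_real)

lemma nevanlinna_kernel_integral:
  assumes \<mu>: "finite_borel_measure \<mu>" and z: "z \<in> upper_half_plane"
  shows "(CLINT x|\<mu>. (z * of_real x - 1) / (z + of_real x))
           = of_real (measure \<mu> UNIV) * z - (1 + z\<^sup>2) * cauchy \<mu> z"
proof -
  interpret finite_borel_measure \<mu> by fact
  have "z + of_real x \<noteq> 0" for x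
    using z Im_le_norm_add_of_real[of z x] by (auto simp: upper_half_plane_def)
  then have "(z * of_real x - 1) / (z + of_real x) = z - (1 + z\<^sup>2) * (1 / (z + of_real x))" for x
    by (simp add: divide_simps) (simp add: power2_eq_square algebra_simps)
  then show ?thesis
    unfolding cauchy_def using cauchy_integrable_upper[OF assms]
    by (simp add: finite_borel_measure_space[OF \<mu>] scaleR_conv_of_real del: times_divide_eq_right)
qed

lemma nevanlinna_rep_imp_cauchy_form:
  assumes rep: "nevanlinna_rep a b \<rho> F"
  shows "cauchy_form F 0 \<rho>"
proof -
  have \<rho>: "finite_borel_measure \<rho>"
    and F: "\<And>z. z \<in> upper_half_plane \<Longrightarrow> F z = of_real a + of_real b * z
          + (of_real (measure \<rho> UNIV) * z - (1 + z\<^sup>2) * cauchy \<rho> z)"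
    using rep by (auto simp: nevanlinna_rep_def nevanlinna_kernel_integral)
  have "F \<i> = of_real a + of_real (b + measure \<rho> UNIV) * \<i>"
    by (subst F) (auto simp: upper_half_plane_def algebra_simps)
  then have "Re (F \<i>) = a" "Im (F \<i>) = b + measure \<rho> UNIV" by simp_all
  then show ?thesis
    unfolding cauchy_form_def using F by (auto simp: algebra_simps)
qed

lemma real_eq_zero_of_linear_bounded:
  fixes c K :: real
  assumes "\<And>y. 1 \<le> y \<Longrightarrow> \<bar>c\<bar> * y \<le> K"
  shows "c = 0"
proof (rule ccontr)
  assume "c \<noteq> 0"
  \<comment> \<open>At this \<open>y\<close> the left-hand side is at least \<open>K + 1\<close>.\<close>
  define y where "y = max 1 ((K + 1) / \<bar>c\<bar>)"
  have "K + 1 \<le> \<bar>c\<bar> * y" using \<open>c \<noteq> 0\<close> by (auto simp: y_def field_simps max_def)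
  with assms[of y] show False by (simp add: y_def)
qed

text \<open>On the rays \<open>z = (\<plusminus>1 + \<i>) * y\<close> the term \<open>c * z\<^sup>2\<close> is \<open>\<plusminus>2 * \<i> * c * y\<^sup>2\<close>, while
\<open>\<bar>cauchy \<mu> z\<bar> \<le> \<mu> \<real> / y\<close> keeps all other terms of order \<open>y\<close>. Positivity of \<open>Im F\<close> on both
rays therefore bounds \<open>\<bar>c\<bar> * y\<close>.\<close>

lemma cauchy_form_constant_eq_0:
  assumes \<mu>: "finite_borel_measure \<mu>" and form: "cauchy_form F c \<mu>"
    and pos: "F ` upper_half_plane \<subseteq> upper_half_plane"
  shows "c = 0"
proof (rule real_eq_zero_of_linear_bounded)
  fix y :: real assume y: "1 \<le> y"
  define m where "m = measure \<mu> UNIV"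
  have key: "2 * c * s * y \<le> Im (F \<i>) + 3 * m" if s: "s = 1 \<or> s = -1" for s :: real
  proof -
    define z where "z = Complex (s * y) y"
    have z: "z \<in> upper_half_plane" using y by (simp add: z_def upper_half_plane_def)
    have z2: "z\<^sup>2 = Complex 0 (2 * s * y\<^sup>2)"
      using s by (auto simp: z_def power2_eq_square complex_eq_iff)
    have "norm (cauchy \<mu> z) \<le> m / y"
      unfolding m_def using y norm_cauchy_le[OF \<mu>, of y z] Im_le_norm_add_of_real[of z]
      by (simp add: z_def)
    moreover have "norm (1 + z\<^sup>2) \<le> 3 * y\<^sup>2"
    proof -
      have "norm (1 + z\<^sup>2) \<le> 1 + norm (z\<^sup>2)" using norm_triangle_ineq[of 1 "z\<^sup>2"] by simp
      also have "norm (z\<^sup>2) = 2 * y\<^sup>2" using s by (auto simp: z2 cmod_def)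
      also have "1 + 2 * y\<^sup>2 \<le> 3 * y\<^sup>2" using one_le_power[OF y, of 2] by simp
      finally show ?thesis .
    qed
    ultimately have "norm ((1 + z\<^sup>2) * cauchy \<mu> z) \<le> (3 * y\<^sup>2) * (m / y)"
      unfolding norm_mult by (intro mult_mono) auto
    then have "\<bar>Im ((1 + z\<^sup>2) * cauchy \<mu> z)\<bar> \<le> 3 * y * m"
      using y abs_Im_le_cmod[of "(1 + z\<^sup>2) * cauchy \<mu> z"]
      by (simp add: power2_eq_square)
    moreover have "Im (F z) = Im (F \<i>) * y - 2 * c * s * y\<^sup>2 - Im ((1 + z\<^sup>2) * cauchy \<mu> z)"
      using form z unfolding cauchy_form_def
      by (simp add: distrib_left z2) (simp add: z_def)
    ultimately have "2 * c * s * y\<^sup>2 \<le> Im (F \<i>) * y + 3 * y * m"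
      using pos z by (force simp: upper_half_plane_def)
    then have "(2 * c * s * y) * y \<le> (Im (F \<i>) + 3 * m) * y"
      by (simp add: power2_eq_square algebra_simps)
    then show ?thesis using y by simp
  qed
  show "\<bar>c\<bar> * y \<le> (Im (F \<i>) + 3 * m) / 2"
    using key[of 1] key[of "-1"] by (simp add: abs_if)
qed

text \<open>Along the imaginary axis, \<open>Im (F (\<i> * y)) / y\<close> is \<open>Im (F \<i>)\<close> minus the integral of
\<open>(y\<^sup>2 - 1) / (x\<^sup>2 + y\<^sup>2)\<close>, and that integral tends to the total mass by dominated convergence.\<close>

lemma cauchy_form_mass_le:
  assumes \<mu>: "finite_borel_measure \<mu>" and form: "cauchy_form F 0 \<mu>"
    and pos: "F ` upper_half_plane \<subseteq> upper_half_plane"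
  shows "measure \<mu> UNIV \<le> Im (F \<i>)"
proof -
  interpret finite_borel_measure \<mu> by fact
  let ?k = "\<lambda>y x. (y\<^sup>2 - 1) / (x\<^sup>2 + y\<^sup>2) :: real"
  have le: "(LINT x|\<mu>. ?k y x) \<le> Im (F \<i>)" if y: "1 \<le> y" for y
  proof -
    define z where "z = \<i> * of_real y"
    have z: "z \<in> upper_half_plane" using y by (simp add: z_def upper_half_plane_def)
    have int: "complex_integrable \<mu> (\<lambda>x. 1 / (z + of_real x))"
      by (rule cauchy_integrable_upper[OF \<mu> z])
    have "Im (cauchy \<mu> z) = (LINT x|\<mu>. Im (1 / (z + of_real x)))"
      unfolding cauchy_def using int by simp
    also have "\<dots> = (LINT x|\<mu>. - y / (x\<^sup>2 + y\<^sup>2))"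
      by (simp add: z_def Im_divide)
    finally have "(1 - y\<^sup>2) * Im (cauchy \<mu> z) = (LINT x|\<mu>. (1 - y\<^sup>2) * (- y / (x\<^sup>2 + y\<^sup>2)))"
      by (simp only: integral_mult_right_zero)
    also have "\<dots> = (LINT x|\<mu>. y * ?k y x)"
    proof -
      have "(1 - y\<^sup>2) * (- y) = y * (y\<^sup>2 - 1)" by (simp add: algebra_simps)
      then show ?thesis by (simp only: times_divide_eq_right)
    qed
    finally have "(1 - y\<^sup>2) * Im (cauchy \<mu> z) = y * (LINT x|\<mu>. ?k y x)"
      by (simp only: integral_mult_right_zero)
    moreover have "1 + z\<^sup>2 = of_real (1 - y\<^sup>2)" by (simp add: z_def power_mult_distrib)
    ultimately have "Im (F z) = Im (F \<i>) * y - y * (LINT x|\<mu>. ?k y x)"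
      using form z unfolding cauchy_form_def by (simp add: z_def)
    then have "y * (LINT x|\<mu>. ?k y x) \<le> y * Im (F \<i>)"
      using pos z by (force simp: upper_half_plane_def mult.commute)
    then show ?thesis using y by simp
  qed
  have "((\<lambda>y. LINT x|\<mu>. ?k y x) \<longlongrightarrow> (LINT x|\<mu>. 1)) at_top"
  proof (rule integral_dominated_convergence_at_top[where w = "\<lambda>_. 1"])
    show "AE x in \<mu>. ((\<lambda>y. ?k y x) \<longlongrightarrow> 1) at_top"
      by (intro AE_I2) real_asymp
    show "\<forall>\<^sub>F y in at_top. AE x in \<mu>. norm (?k y x) \<le> 1"
      using eventually_ge_at_top[of 1]
    proof eventually_elim
      case (elim y)
      have "\<bar>?k y x\<bar> \<le> 1" for x
      proof -
        have "1 \<le> y\<^sup>2" using elim by simp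
        then show ?thesis by (simp add: abs_if divide_simps) (smt (verit) zero_le_power2)
      qed
      then show ?case by simp
    qed
  qed (auto simp: finite_borel_measure_measurable[OF \<mu>])
  then show ?thesis
    using le by (intro tendsto_upperbound[where F = at_top])
      (auto simp: finite_borel_measure_space[OF \<mu>] intro: eventually_mono[OF eventually_ge_at_top[of 1]])
qed

lemma nevanlinna_on_iff_cauchy_form:
  assumes pos: "F ` upper_half_plane \<subseteq> upper_half_plane"
  shows "F \<in> nevanlinna_on A \<longleftrightarrow> (\<exists>\<mu>. finite_measure_on A \<mu> \<and> cauchy_form F 0 \<mu>)"
proof
  assume "F \<in> nevanlinna_on A"
  then show "\<exists>\<mu>. finite_measure_on A \<mu> \<and> cauchy_form F 0 \<mu>"
    using nevanlinna_rep_imp_cauchy_form by (auto simp: nevanlinna_on_def)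
next
  assume "\<exists>\<mu>. finite_measure_on A \<mu> \<and> cauchy_form F 0 \<mu>"
  then obtain \<mu> where A: "finite_measure_on A \<mu>" and form: "cauchy_form F 0 \<mu>" by blast
  then have \<mu>: "finite_borel_measure \<mu>" by (simp add: finite_measure_on_def)
  have "nevanlinna_rep (Re (F \<i>)) (Im (F \<i>) - measure \<mu> UNIV) \<mu> F"
    unfolding nevanlinna_rep_def
  proof (intro conjI ballI)
    show "0 \<le> Im (F \<i>) - measure \<mu> UNIV"
      using cauchy_form_mass_le[OF \<mu> form pos] by simp
    fix z assume z: "z \<in> upper_half_plane"
    show "F z = of_real (Re (F \<i>)) + of_real (Im (F \<i>) - measure \<mu> UNIV) * z
            + (CLINT x|\<mu>. (z * of_real x - 1) / (z + of_real x))"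
      unfolding nevanlinna_kernel_integral[OF \<mu> z]
      using form z unfolding cauchy_form_def by (simp add: algebra_simps)
  qed fact
  with A show "F \<in> nevanlinna_on A"
    by (auto simp: nevanlinna_on_def nevanlinna_def)
qed

section \<open>The function G\<close>

lemma one_plus_square_nonzero:
  assumes "z \<in> upper_half_plane" "z \<noteq> \<i>"
  shows "1 + z\<^sup>2 \<noteq> 0"
proof
  assume "1 + z\<^sup>2 = 0"
  then have "(z - \<i>) * (z + \<i>) = 0" by (simp add: algebra_simps power2_eq_square)
  with assms show False by (auto simp: upper_half_plane_def add_eq_0_iff2)
qed

text \<open>At \<open>\<i>\<close> the value of \<open>G\<close> is a limit, which the continuity of the Cauchy transform identifies;
conversely, at \<open>\<i>\<close> the equation of the form reduces to
\<open>F \<i> = Re (F \<i>) + Im (F \<i>) * \<i>\<close>.\<close>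

lemma cauchy_form_iff_G_fun:
  assumes \<mu>: "finite_borel_measure \<mu>"
  shows "cauchy_form F c \<mu> \<longleftrightarrow>
           (\<forall>z\<in>upper_half_plane. G_fun F z = of_real c + cauchy \<mu> z)"
proof
  assume form: "cauchy_form F c \<mu>"
  have raw: "G_raw F z = of_real c + cauchy \<mu> z" if "z \<in> upper_half_plane" "z \<noteq> \<i>" for z
    using form that one_plus_square_nonzero[OF that] unfolding cauchy_form_def G_raw_def by simp
  have i: "\<i> \<in> upper_half_plane" by (simp add: upper_half_plane_def)
  have "isCont (\<lambda>z. of_real c + cauchy \<mu> z) \<i>"
    using holomorphic_on_imp_continuous_on[OF cauchy_holomorphic_upper[OF \<mu>]] i
    by (auto simp: continuous_on_eq_continuous_at[OF open_upper_half_plane])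
  then have "((\<lambda>z. of_real c + cauchy \<mu> z) \<longlongrightarrow> of_real c + cauchy \<mu> \<i>) (at \<i>)"
    by (simp add: isCont_def)
  then have "(G_raw F \<longlongrightarrow> of_real c + cauchy \<mu> \<i>) (at \<i>)"
    by (rule Lim_transform_within_open[OF _ open_upper_half_plane i]) (simp add: raw)
  then have "Lim (at \<i>) (G_raw F) = of_real c + cauchy \<mu> \<i>"
    by (intro tendsto_Lim) auto
  with raw show "\<forall>z\<in>upper_half_plane. G_fun F z = of_real c + cauchy \<mu> z"
    by (auto simp: G_fun_def)
next
  assume G: "\<forall>z\<in>upper_half_plane. G_fun F z = of_real c + cauchy \<mu> z"
  show "cauchy_form F c \<mu>"
    unfolding cauchy_form_def
  proof
    fix z assume z: "z \<in> upper_half_plane"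
    show "F z = of_real (Re (F \<i>)) + of_real (Im (F \<i>)) * z - (1 + z\<^sup>2) * (of_real c + cauchy \<mu> z)"
    proof (cases "z = \<i>")
      case True
      then show ?thesis by (simp add: complex_eq[symmetric] mult.commute)
    next
      case False
      then have "of_real c + cauchy \<mu> z = G_raw F z" using G z by (metis G_fun_def)
      then show ?thesis
        using one_plus_square_nonzero[OF z False] by (simp add: G_raw_def)
    qed
  qed
qed


section \<open>Laplace transforms and the function H\<close>

lemma laplace_exp_complex:
  fixes p :: complex
  assumes p: "0 < Re p"
  shows "set_integrable lborel {0..} (\<lambda>s. exp (- p * of_real s))"
    and "(CLBINT s:{0..}. exp (- p * of_real s)) = 1 / p"
proof -
  have diff: "({0..} - {0<..}) \<union> ({0<..} - {0..}) \<subseteq> {0::real}" by auto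
  have int: "set_integrable lborel {0<..} (\<lambda>s. exp (- p * of_real s))"
  proof (rule set_integrable_bound[OF integrable_I0i_exp_mscale[OF p]])
    show "set_borel_measurable lborel {0<..} (\<lambda>s. exp (- p * of_real s))"
      unfolding set_borel_measurable_def by measurable
  qed (auto simp: mult.commute)
  then show "set_integrable lborel {0..} (\<lambda>s. exp (- p * of_real s))"
    by (subst set_integrable_discrete_difference[OF _ diff]) auto
  have "(CLBINT s:{0..}. exp (- p * of_real s)) = (CLBINT s:{0<..}. exp (- p * of_real s))"
    by (rule set_integral_discrete_difference[OF _ diff]) auto
  also have "\<dots> = (CLBINT s=0..\<infinity>. exp (- p * of_real s))"
    by (simp add: interval_lebesgue_integral_0_infty)
  also have "\<dots> = 0 - (- (1 / p))"
  proof (rule interval_integral_FTC_integrable[where F = "\<lambda>s. - exp (- p * of_real s) / p"])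
    show "((\<lambda>s. - exp (- p * of_real s) / p) has_vector_derivative exp (- p * of_real x)) (at x)"
      for x :: real
    proof -
      have "((\<lambda>s. - exp (- p * s) / p) has_field_derivative exp (- p * of_real x)) (at (of_real x))"
        using p by (auto intro!: derivative_eq_intros)
      then show ?thesis by (rule has_vector_derivative_real_field)
    qed
    show "set_integrable lborel (einterval 0 \<infinity>) (\<lambda>s. exp (- p * of_real s))"
      using int by (simp add: zero_ereal_def)
    have "((\<lambda>s::real. - exp (- p * of_real s) / p) \<longlongrightarrow> - exp (- p * of_real 0) / p) (at_right 0)"
      by (intro tendsto_intros) (use p in auto)
    then show "(((\<lambda>s. - exp (- p * of_real s) / p) \<circ> real_of_ereal) \<longlongrightarrow> - (1 / p)) (at_right 0)"
      by (simp add: zero_ereal_def ereal_tendsto_simps)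
    have "((\<lambda>s::real. exp (- c * s) / n) \<longlongrightarrow> 0) at_top" if "0 < c" "0 < n" for c n :: real
      using that by real_asymp
    moreover have "0 < norm p" using p by auto
    ultimately have "((\<lambda>s::real. exp (- Re p * s) / norm p) \<longlongrightarrow> 0) at_top"
      using p by blast
    then have "((\<lambda>s::real. norm (- exp (- p * of_real s) / p)) \<longlongrightarrow> 0) at_top"
      by (simp add: norm_divide)
    then have "((\<lambda>s::real. - exp (- p * of_real s) / p) \<longlongrightarrow> 0) at_top"
      by (rule tendsto_norm_zero_cancel)
    then show "(((\<lambda>s. - exp (- p * of_real s) / p) \<circ> real_of_ereal) \<longlongrightarrow> 0) (at_left \<infinity>)"
      by (simp add: ereal_tendsto_simps)
  qed (auto intro!: continuous_intros)
  finally show "(CLBINT s:{0..}. exp (- p * of_real s)) = 1 / p" by simp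
qed

text \<open>Fubini: the inner integral of \<open>exp (- w * s) * exp (\<i> * s * x)\<close> over \<open>s\<close> is
\<open>1 / (w - \<i> * x) = \<i> / (\<i> * w + x)\<close>. The integrability claim matters in its own right: it
allows the transform of \<open>char \<rho> + \<dots>\<close> to be split into summands.\<close>

lemma laplace_char:
  assumes \<rho>: "finite_borel_measure \<rho>" and w: "0 < w"
  shows "set_integrable lborel {0..} (\<lambda>s. of_real (exp (- w * s)) * char \<rho> s)"
    and "laplace_transform (char \<rho>) w = \<i> * cauchy \<rho> (\<i> * of_real w)"
proof -
  interpret finite_borel_measure \<rho> by fact
  interpret pair_sigma_finite lborel \<rho> ..
  note [measurable_cong] = M_is_borel
  define f :: "real \<Rightarrow> real \<Rightarrow> complex"
    where "f s x = indicator {0..} s *\<^sub>R (of_real (exp (- w * s)) * iexp (s * x))" for s x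
  have norm_f: "norm (f s x) = indicator {0..} s *\<^sub>R exp (- w * s)" for s x
    by (simp add: f_def norm_mult)
  have f_eq: "f s x = indicator {0..} s *\<^sub>R exp (- (of_real w - \<i> * of_real x) * of_real s)" for s x
  proof -
    have "exp (- (of_real w - \<i> * of_real x) * of_real s)
        = exp (of_real (- w * s) + \<i> * of_real (s * x))"
      by (rule arg_cong[where f = exp]) (simp add: algebra_simps)
    then show ?thesis by (simp only: f_def exp_add exp_of_real)
  qed
  have exp_int: "integrable lborel (\<lambda>s. indicator {0..} s *\<^sub>R exp (- w * s))"
  proof -
    have "set_integrable lborel {0..} (\<lambda>s. norm (exp (- complex_of_real w * of_real s)))"
      using laplace_exp_complex(1)[of "of_real w"] w by (intro set_integrable_norm) auto
    then show ?thesis by (simp add: set_integrable_def)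
  qed
  have f_int: "integrable (lborel \<Otimes>\<^sub>M \<rho>) (case_prod f)"
  proof (rule Fubini_integrable)
    show "case_prod f \<in> borel_measurable (lborel \<Otimes>\<^sub>M \<rho>)"
      unfolding f_def by measurable
    show "integrable lborel (\<lambda>s. LINT x|\<rho>. norm (case_prod f (s, x)))"
    proof -
      have "integrable lborel
          (\<lambda>s. measure \<rho> (space \<rho>) * (indicator {0..} s *\<^sub>R exp (- w * s)))"
        by (rule integrable_mult_right[OF exp_int])
      then show ?thesis by (simp only: norm_f prod.case lebesgue_integral_const real_scaleR_def)
    qed
    show "AE s in lborel. complex_integrable \<rho> (\<lambda>x. case_prod f (s, x))"
    proof (rule AE_I2)
      fix s :: real
      show "complex_integrable \<rho> (\<lambda>x. case_prod f (s, x))"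
        by (rule integrable_const_bound[where B = "indicator {0..} s *\<^sub>R exp (- w * s)"])
          (auto simp: norm_f, simp add: f_def)
    qed
  qed
  have inner: "(CLINT x|\<rho>. f s x) = indicator {0..} s *\<^sub>R (of_real (exp (- w * s)) * char \<rho> s)" for s
    unfolding f_def char_def by simp
  show "set_integrable lborel {0..} (\<lambda>s. of_real (exp (- w * s)) * char \<rho> s)"
    using integrable_fst[OF f_int] by (simp only: inner set_integrable_def)
  have "laplace_transform (char \<rho>) w = (CLBINT s. (CLINT x|\<rho>. f s x))"
    by (simp only: laplace_transform_def set_lebesgue_integral_def inner)
  also have "\<dots> = (CLINT x|\<rho>. CLBINT s. f s x)"
    by (rule Fubini_integral[OF f_int, symmetric])
  also have "\<dots> = (CLINT x|\<rho>. \<i> * (1 / (\<i> * of_real w + of_real x)))"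
  proof (rule Bochner_Integration.integral_cong)
    fix x
    have nz: "of_real w - \<i> * of_real x \<noteq> 0" using w by (auto simp: complex_eq_iff)
    have "(CLBINT s. f s x) = 1 / (of_real w - \<i> * of_real x)"
      using laplace_exp_complex(2)[of "of_real w - \<i> * of_real x"] w
      by (simp add: f_eq set_lebesgue_integral_def)
    also have "\<i> * of_real w + of_real x = \<i> * (of_real w - \<i> * of_real x)"
      by (simp add: algebra_simps)
    then have "1 / (of_real w - \<i> * of_real x) = \<i> * (1 / (\<i> * of_real w + of_real x))"
      using nz by simp
    finally show "(CLBINT s. f s x) = \<i> * (1 / (\<i> * of_real w + of_real x))" .
  qed simp
  also have "\<dots> = \<i> * cauchy \<rho> (\<i> * of_real w)"
    unfolding cauchy_def by (rule integral_mult_right_zero)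
  finally show "laplace_transform (char \<rho>) w = \<i> * cauchy \<rho> (\<i> * of_real w)" .
qed

text \<open>With \<open>sinh\<close> and \<open>cosh\<close> written as combinations of \<open>exp s\<close> and \<open>exp (- s)\<close>, the two
extra terms become \<open>A * exp (- (w - 1) * s) + B * exp (- (w + 1) * s)\<close>, which is integrable
because \<open>w > 1\<close>.\<close>

lemma laplace_char_sinh_cosh:
  assumes \<rho>: "finite_borel_measure \<rho>" and w: "1 < w"
  shows "laplace_transform
           (\<lambda>s. char \<rho> s + \<i> * of_real a * of_real (sinh s) - of_real b * of_real (cosh s)) w
         = \<i> * cauchy \<rho> (\<i> * of_real w) + (\<i> * of_real a - of_real b * of_real w) / of_real (w\<^sup>2 - 1)"
proof -
  define p q where "p = complex_of_real (w - 1)" and "q = complex_of_real (w + 1)"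
  define A B where "A = (\<i> * of_real a - of_real b) / 2" and "B = - (\<i> * of_real a + of_real b) / 2"
  have pq: "0 < Re p" "0 < Re q" using w by (simp_all add: p_def q_def)
  have eq: "of_real (exp (- w * s))
        * (char \<rho> s + \<i> * of_real a * of_real (sinh s) - of_real b * of_real (cosh s))
      = of_real (exp (- w * s)) * char \<rho> s
        + (A * exp (- p * of_real s) + B * exp (- q * of_real s))" for s
  proof -
    have "exp (- p * of_real s) = of_real (exp (- w * s) * exp s)"
      "exp (- q * of_real s) = of_real (exp (- w * s) * exp (- s))"
      unfolding exp_add[symmetric] exp_of_real[symmetric]
      by (simp_all add: p_def q_def algebra_simps)
    then show ?thesis
      by (simp add: A_def B_def sinh_def cosh_def field_simps)
  qed
  have "laplace_transform
          (\<lambda>s. char \<rho> s + \<i> * of_real a * of_real (sinh s) - of_real b * of_real (cosh s)) w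
      = laplace_transform (char \<rho>) w
        + (A * (CLBINT s:{0..}. exp (- p * of_real s)) + B * (CLBINT s:{0..}. exp (- q * of_real s)))"
    unfolding laplace_transform_def eq
    using laplace_char(1)[OF \<rho>, of w] w laplace_exp_complex(1)[OF pq(1)] laplace_exp_complex(1)[OF pq(2)]
    by (subst set_integral_add; (subst set_integral_add)?) (auto intro!: set_integral_add)
  also have "\<dots> = \<i> * cauchy \<rho> (\<i> * of_real w) + (A / p + B / q)"
    using laplace_char(2)[OF \<rho>, of w] w pq laplace_exp_complex(2) by simp
  also have "A / p + B / q = (\<i> * of_real a - of_real b * of_real w) / of_real (w\<^sup>2 - 1)"
  proof -
    have nz: "p \<noteq> 0" "q \<noteq> 0" using pq by auto
    have "complex_of_real (w\<^sup>2 - 1) = p * q"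
      by (simp add: p_def q_def power2_eq_square algebra_simps)
    moreover have "A * q + B * p = \<i> * of_real a - of_real b * of_real w"
      by (simp add: A_def B_def p_def q_def field_simps)
    ultimately show ?thesis using nz by (simp add: add_frac_eq mult.commute)
  qed
  finally show ?thesis .
qed

lemma holomorphic_pick_remainder:
  assumes "F holomorphic_on S" "cauchy \<mu> holomorphic_on S"
  shows "(\<lambda>z. F z - (a + b * z - (1 + z\<^sup>2) * (c + cauchy \<mu> z))) holomorphic_on S"
  using assms by (intro holomorphic_intros)

text \<open>The Laplace formula at \<open>w\<close> is the equation of the form at the point \<open>\<i> * w\<close>. These points
accumulate inside the upper half plane, so the identity theorem applies.\<close>

lemma cauchy_form_iff_H_fun:
  assumes \<mu>: "finite_borel_measure \<mu>" and F: "F holomorphic_on upper_half_plane"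
  shows "cauchy_form F 0 \<mu> \<longleftrightarrow>
    (\<forall>w>1. H_fun F w = laplace_transform
      (\<lambda>s. char \<mu> s + \<i> * of_real (Re (F \<i>)) * of_real (sinh s)
              - of_real (Im (F \<i>)) * of_real (cosh s)) w)"
proof -
  define R where "R z = F z - (of_real (Re (F \<i>)) + of_real (Im (F \<i>)) * z
                  - (1 + z\<^sup>2) * (of_real 0 + cauchy \<mu> z))" for z
  have H_iff: "H_fun F w = laplace_transform
      (\<lambda>s. char \<mu> s + \<i> * of_real (Re (F \<i>)) * of_real (sinh s)
              - of_real (Im (F \<i>)) * of_real (cosh s)) w
      \<longleftrightarrow> R (\<i> * of_real w) = 0" if w: "1 < w" for w
  proof -
    define a b k f where "a = complex_of_real (Re (F \<i>))" and "b = complex_of_real (Im (F \<i>))"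
      and "k = cauchy \<mu> (\<i> * of_real w)" and "f = F (\<i> * of_real w)"
    define d where "d = complex_of_real (w\<^sup>2 - 1)"
    have "w\<^sup>2 - 1 \<noteq> 0" using w by (smt (verit) one_less_power zero_less_numeral)
    then have d: "d \<noteq> 0" unfolding d_def by (simp only: of_real_eq_0_iff not_False_eq_True)
    have sq: "1 + (\<i> * of_real w)\<^sup>2 = - d" by (simp add: d_def power_mult_distrib)
    have "\<i> * f / d = \<i> * k + (\<i> * a - b * of_real w) / d
        \<longleftrightarrow> \<i> * f = \<i> * (d * k + a + b * (\<i> * of_real w))"
      using d by (simp add: field_simps)
    also have "\<dots> \<longleftrightarrow> f - (a + b * (\<i> * of_real w) - (- d) * k) = 0"
      unfolding mult_cancel_left by (auto simp: algebra_simps)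
    finally show ?thesis
      unfolding laplace_char_sinh_cosh[OF \<mu> w] H_fun_def R_def sq
      by (simp add: a_def b_def d_def f_def k_def)
  qed
  have "(\<forall>z\<in>upper_half_plane. R z = 0) \<longleftrightarrow> (\<forall>w>1. R (\<i> * of_real w) = 0)"
  proof (intro iffI ballI allI impI)
    fix w :: real assume "\<forall>z\<in>upper_half_plane. R z = 0" "1 < w"
    then show "R (\<i> * of_real w) = 0" by (simp add: upper_half_plane_def)
  next
    fix z assume zero: "\<forall>w>1. R (\<i> * of_real w) = 0" and z: "z \<in> upper_half_plane"
    show "R z = 0"
    proof (rule analytic_continuation[where f = R and S = upper_half_plane
          and U = "(\<lambda>w. \<i> * of_real w) ` {1<..}" and \<xi> = "\<i> * of_real 2"])
      show "R holomorphic_on upper_half_plane"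
        unfolding R_def by (rule holomorphic_pick_remainder[OF F cauchy_holomorphic_upper[OF \<mu>]])
      show "\<i> * of_real 2 islimpt (\<lambda>w. \<i> * of_real w) ` {1<..}"
        unfolding islimpt_approachable
      proof (intro allI impI)
        fix e :: real assume "0 < e"
        then have "dist (\<i> * of_real (2 + e / 2)) (\<i> * of_real 2) < e"
          by (simp add: dist_norm norm_mult distrib_left)
        moreover have "\<i> * of_real (2 + e / 2) \<noteq> \<i> * of_real 2"
          using \<open>0 < e\<close> by (simp add: complex_eq_iff)
        moreover have "\<i> * of_real (2 + e / 2) \<in> (\<lambda>w. \<i> * of_real w) ` {1<..}"
          using \<open>0 < e\<close> by (intro imageI) simp
        ultimately show "\<exists>x'\<in>(\<lambda>w. \<i> * of_real w) ` {1<..}.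
            x' \<noteq> \<i> * of_real 2 \<and> dist x' (\<i> * of_real 2) < e" by blast
      qed
    qed (use zero z open_upper_half_plane connected_upper_half_plane in \<open>auto simp: upper_half_plane_def\<close>)
  qed
  then show ?thesis
    using H_iff by (auto simp: cauchy_form_def R_def)
qed

section \<open>Extension to the positive half-line\<close>

text \<open>Boundary uniqueness without reflection: since \<open>f\<close> vanishes on the positive axis, extending it by
zero to the fourth quadrant gives a continuous function on the right half plane that is
holomorphic off the axis, hence holomorphic. It vanishes on an open set, so it vanishes.\<close>

lemma zero_on_quadrant_if_zero_on_positive_axis:
  assumes cont: "continuous_on {z. 0 < Re z \<and> 0 \<le> Im z} f"
    and hol: "f holomorphic_on {z. 0 < Re z \<and> 0 < Im z}"
    and zero: "\<And>t. 0 < t \<Longrightarrow> f (of_real t) = 0"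
    and z: "0 < Re z" "0 < Im z"
  shows "f z = 0"
proof -
  define S where "S = {z. 0 < Re z}"
  define g where "g z = (if 0 \<le> Im z then f z else 0)" for z
  have "open S" and "connected S"
    unfolding S_def by (simp_all add: open_halfspace_Re_gt convex_connected convex_halfspace_Re_gt)
  have "g holomorphic_on S"
    \<comment> \<open>As \<open>\<i> \<bullet> z = Im z\<close>, the pieces are glued along the real axis.\<close>
  proof (rule holomorphic_on_paste_across_line[where d = \<i> and k = 0])
    show "g holomorphic_on S \<inter> {z. \<i> \<bullet> z < 0}"
      by (rule holomorphic_transform[of "\<lambda>_. 0"]) (auto simp: g_def)
    show "g holomorphic_on S \<inter> {z. 0 < \<i> \<bullet> z}"
      by (rule holomorphic_transform[of f]) (use hol in \<open>auto simp: g_def S_def Collect_conj_eq\<close>)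
    have "continuous_on ({z\<in>S. 0 \<le> Im z} \<union> {z\<in>S. Im z \<le> 0}) (\<lambda>z. if 0 \<le> Im z then f z else 0)"
    proof (rule continuous_on_cases_local)
      have "closed {z. 0 \<le> Im z}" "closed {z. Im z \<le> 0}"
        by (simp_all add: closed_halfspace_Im_ge closed_halfspace_Im_le)
      then show "closedin (top_of_set ({z\<in>S. 0 \<le> Im z} \<union> {z\<in>S. Im z \<le> 0})) {z\<in>S. 0 \<le> Im z}"
        "closedin (top_of_set ({z\<in>S. 0 \<le> Im z} \<union> {z\<in>S. Im z \<le> 0})) {z\<in>S. Im z \<le> 0}"
        unfolding closedin_closed by blast+
      show "continuous_on {z\<in>S. 0 \<le> Im z} f" using cont by (simp add: S_def)
      fix z assume "z \<in> {z\<in>S. 0 \<le> Im z} \<and> \<not> 0 \<le> Im z \<or> z \<in> {z\<in>S. Im z \<le> 0} \<and> 0 \<le> Im z"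
      then have "0 < Re z" "z = of_real (Re z)" by (auto simp: S_def complex_eq_iff)
      then show "f z = 0" using zero by metis
    qed simp
    also have "{z\<in>S. 0 \<le> Im z} \<union> {z\<in>S. Im z \<le> 0} = S" by auto
    finally show "continuous_on S g" unfolding g_def .
  qed (use \<open>open S\<close> in auto)
  then have "g z = 0"
  proof (rule analytic_continuation_open[where s = "{z. 0 < Re z} \<inter> {z. Im z < 0}" and s' = S, rotated 5])
    show "open ({z. 0 < Re z} \<inter> {z. Im z < 0})"
      by (intro open_Int open_halfspace_Re_gt open_halfspace_Im_lt)
    have "Complex 1 (-1) \<in> {z. 0 < Re z} \<inter> {z. Im z < 0}" by simp
    then show "{z. 0 < Re z} \<inter> {z. Im z < 0} \<noteq> {}" by blast
  qed (use \<open>open S\<close> \<open>connected S\<close> z in \<open>auto simp: S_def g_def\<close>)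
  with z show ?thesis by (simp add: g_def)
qed

lemma cauchy_of_real_pos:
  assumes \<mu>: "finite_measure_on {0..} \<mu>" and t: "0 < t"
  shows "cauchy \<mu> (of_real t) = of_real (LINT u:{0..}|\<mu>. 1 / (t + u))"
    and "0 \<le> (LINT u:{0..}|\<mu>. 1 / (t + u))"
proof -
  have fbm: "finite_borel_measure \<mu>" using \<mu> by (simp add: finite_measure_on_def)
  have "cauchy \<mu> (of_real t) = (CLINT u|\<mu>. of_real (indicator {0..} u *\<^sub>R (1 / (t + u))))"
    unfolding cauchy_def
  proof (rule integral_cong_AE)
    show "AE u in \<mu>. 1 / (complex_of_real t + of_real u) = of_real (indicator {0..} u *\<^sub>R (1 / (t + u)))"
      using finite_measure_on_AE[OF \<mu> borel_closed[OF closed_atLeast]]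
      by eventually_elim simp
  qed (simp_all add: finite_borel_measure_measurable[OF fbm])
  then show "cauchy \<mu> (of_real t) = of_real (LINT u:{0..}|\<mu>. 1 / (t + u))"
    by (simp only: integral_complex_of_real set_lebesgue_integral_def)
  show "0 \<le> (LINT u:{0..}|\<mu>. 1 / (t + u))"
    unfolding set_lebesgue_integral_def
    by (rule Bochner_Integration.integral_nonneg) (use t in \<open>auto simp: indicator_def\<close>)
qed

text \<open>The remainder \<open>R F\<close>, whose vanishing is the claim, is holomorphic in the upper half plane.
To see its boundary values, \<open>F\<close> is replaced by \<open>F'\<close>, the function built from the extension
\<open>g\<close> in place of \<open>G\<close>: it coincides with \<open>F\<close> in the upper half plane and is continuous up to
the positive axis, where the Stieltjes formula makes \<open>R F'\<close> vanish. This settles the first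
quadrant, and the identity theorem the rest.\<close>

lemma stieltjes_extension_imp_cauchy_form:
  assumes F: "F holomorphic_on upper_half_plane"
    and ext: "continuous_extension_to_pos (G_fun F) g h"
    and \<mu>: "finite_measure_on {0..} \<mu>"
    and h: "\<And>t. 0 < t \<Longrightarrow> h t = d + (LINT u:{0..}|\<mu>. 1 / (t + u))"
  shows "cauchy_form F d \<mu>"
proof -
  have fbm: "finite_borel_measure \<mu>" using \<mu> by (simp add: finite_measure_on_def)
  define a b where "a = complex_of_real (Re (F \<i>))" and "b = complex_of_real (Im (F \<i>))"
  define F' where "F' z = a + b * z - (1 + z\<^sup>2) * g z" for z
  define R where "R E z = E z - (a + b * z - (1 + z\<^sup>2) * (of_real d + cauchy \<mu> z))" for E z
  have F'_eq: "F' z = F z" if z: "z \<in> upper_half_plane" for z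
  proof (cases "z = \<i>")
    case True
    then show ?thesis by (simp add: F'_def a_def b_def complex_eq[symmetric] mult.commute)
  next
    case False
    then have "g z = G_raw F z"
      using ext z by (simp add: continuous_extension_to_pos_def G_fun_def)
    then show ?thesis
      using one_plus_square_nonzero[OF z False] by (simp add: F'_def G_raw_def a_def b_def)
  qed
  have R_hol: "R F holomorphic_on upper_half_plane"
    unfolding R_def by (rule holomorphic_pick_remainder[OF F cauchy_holomorphic_upper[OF fbm]])
  have quadrant: "R F z = 0" if "0 < Re z" "0 < Im z" for z
  proof -
    have "R F' z = 0"
    proof (rule zero_on_quadrant_if_zero_on_positive_axis[OF _ _ _ that])
      have "z \<in> upper_half_plane \<union> of_real ` {0<..}" if "0 < Re z" "0 \<le> Im z" for z
      proof (cases "Im z = 0")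
        case True
        then have "z = of_real (Re z)" by (simp add: complex_eq_iff)
        with that show ?thesis by (metis UnI2 greaterThan_iff imageI)
      qed (use that in \<open>auto simp: upper_half_plane_def\<close>)
      then have "continuous_on {z. 0 < Re z \<and> 0 \<le> Im z} g"
        using ext unfolding continuous_extension_to_pos_def
        by (auto intro: continuous_on_subset)
      moreover have "continuous_on {z. 0 < Re z \<and> 0 \<le> Im z} (cauchy \<mu>)"
        using holomorphic_on_imp_continuous_on[OF cauchy_holomorphic_right[OF \<mu>]]
        by (rule continuous_on_subset) auto
      ultimately show "continuous_on {z. 0 < Re z \<and> 0 \<le> Im z} (R F')"
        unfolding R_def F'_def by (intro continuous_intros)
      show "R F' holomorphic_on {z. 0 < Re z \<and> 0 < Im z}"
        by (rule holomorphic_transform[OF holomorphic_on_subset[OF R_hol]])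
          (auto simp: upper_half_plane_def R_def F'_eq)
      fix t :: real assume t: "0 < t"
      then have "g (of_real t) = of_real d + cauchy \<mu> (of_real t)"
        using ext h by (simp add: continuous_extension_to_pos_def cauchy_of_real_pos[OF \<mu>])
      then show "R F' (of_real t) = 0" by (simp add: R_def F'_def)
    qed
    then show ?thesis using that by (simp add: R_def F'_eq upper_half_plane_def)
  qed
  have "R F z = 0" if "z \<in> upper_half_plane" for z
  proof (rule analytic_continuation_open[where s = "{z. 0 < Re z} \<inter> {z. 0 < Im z}" and s' = upper_half_plane
        and f = "R F" and g = "\<lambda>_. 0"])
    show "open ({z. 0 < Re z} \<inter> {z. 0 < Im z})"
      by (intro open_Int open_halfspace_Re_gt open_halfspace_Im_gt)
    have "Complex 1 1 \<in> {z. 0 < Re z} \<inter> {z. 0 < Im z}" by simp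
    then show "{z. 0 < Re z} \<inter> {z. 0 < Im z} \<noteq> {}" by blast
    show "{z. 0 < Re z} \<inter> {z. 0 < Im z} \<subseteq> upper_half_plane"
      by (auto simp: upper_half_plane_def)
  qed (use quadrant R_hol that open_upper_half_plane connected_upper_half_plane in auto)
  then show ?thesis by (simp add: cauchy_form_def R_def a_def b_def)
qed

lemma cauchy_form_imp_stieltjes_extension:
  assumes \<mu>: "finite_measure_on {0..} \<mu>" and form: "cauchy_form F 0 \<mu>"
  shows "continuous_extension_to_pos (G_fun F) (cauchy \<mu>) (\<lambda>t. LINT u:{0..}|\<mu>. 1 / (t + u))"
proof -
  have fbm: "finite_borel_measure \<mu>" using \<mu> by (simp add: finite_measure_on_def)
  have "cauchy \<mu> holomorphic_on upper_half_plane \<union> {z. 0 < Re z}"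
    by (rule holomorphic_on_Un[OF cauchy_holomorphic_upper[OF fbm] cauchy_holomorphic_right[OF \<mu>]
        open_upper_half_plane open_halfspace_Re_gt])
  then have "continuous_on (upper_half_plane \<union> of_real ` {0<..}) (cauchy \<mu>)"
    by (rule continuous_on_subset[OF holomorphic_on_imp_continuous_on]) auto
  moreover have "\<forall>z\<in>upper_half_plane. cauchy \<mu> z = G_fun F z"
    using form by (simp add: cauchy_form_iff_G_fun[OF fbm])
  ultimately show ?thesis
    by (simp add: continuous_extension_to_pos_def cauchy_of_real_pos[OF \<mu>])
qed

section \<open>The equivalences\<close>

theorem theorem1:
  fixes A :: "real set" and F :: "complex \<Rightarrow> complex"
  assumes "A \<in> sets borel"
    and "F analytic_on upper_half_plane"
    and "F ` upper_half_plane \<subseteq> upper_half_plane"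
  shows "(F \<in> nevanlinna_on A \<longleftrightarrow>
           (\<exists>\<mu>. finite_measure_on A \<mu> \<and> is_cauchy_transform (G_fun F) \<mu>)) \<and>
         (F \<in> nevanlinna_on A \<longleftrightarrow>
           (\<exists>\<rho>. finite_measure_on A \<rho> \<and>
             (\<forall>w>1. H_fun F w =
                laplace_transform
                  (\<lambda>s. char \<rho> s + \<i> * of_real (Re (F \<i>)) * of_real (sinh s)
                        - of_real (Im (F \<i>)) * of_real (cosh s)) w))) \<and>
         (F \<in> nevanlinna_on {0..} \<longleftrightarrow>
           (\<exists>g h. continuous_extension_to_pos (G_fun F) g h \<and>
             (\<exists>\<mu>. finite_measure_on {0..} \<mu> \<and> is_stieltjes_transform h \<mu>)))"
proof (intro conjI)
  have hol: "F holomorphic_on upper_half_plane"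
    using assms(2) by (rule analytic_imp_holomorphic)
  have fbm: "finite_borel_measure \<mu>" if "finite_measure_on B \<mu>" for B \<mu>
    using that by (simp add: finite_measure_on_def)
  note form_iff = nevanlinna_on_iff_cauchy_form[OF assms(3)]
  have "is_cauchy_transform (G_fun F) \<mu> \<longleftrightarrow> cauchy_form F 0 \<mu>" if "finite_measure_on A \<mu>" for \<mu>
  proof -
    have "is_cauchy_transform (G_fun F) \<mu> \<longleftrightarrow> (\<exists>c. cauchy_form F c \<mu>)"
      by (simp add: is_cauchy_transform_def cauchy_form_iff_G_fun[OF fbm[OF that]] cauchy_def)
    also have "\<dots> \<longleftrightarrow> cauchy_form F 0 \<mu>"
      using cauchy_form_constant_eq_0[OF fbm[OF that] _ assms(3)] by blast
    finally show ?thesis .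
  qed
  then show "F \<in> nevanlinna_on A \<longleftrightarrow>
      (\<exists>\<mu>. finite_measure_on A \<mu> \<and> is_cauchy_transform (G_fun F) \<mu>)"
    using form_iff by blast
  show "F \<in> nevanlinna_on A \<longleftrightarrow>
      (\<exists>\<rho>. finite_measure_on A \<rho> \<and>
        (\<forall>w>1. H_fun F w = laplace_transform
          (\<lambda>s. char \<rho> s + \<i> * of_real (Re (F \<i>)) * of_real (sinh s)
                - of_real (Im (F \<i>)) * of_real (cosh s)) w))"
    unfolding form_iff using cauchy_form_iff_H_fun[OF fbm hol] by blast
  show "F \<in> nevanlinna_on {0..} \<longleftrightarrow>
      (\<exists>g h. continuous_extension_to_pos (G_fun F) g h \<and>
        (\<exists>\<mu>. finite_measure_on {0..} \<mu> \<and> is_stieltjes_transform h \<mu>))"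
    unfolding form_iff
  proof
    assume "\<exists>\<mu>. finite_measure_on {0..} \<mu> \<and> cauchy_form F 0 \<mu>"
    then obtain \<mu> where \<mu>: "finite_measure_on {0..} \<mu>" and form: "cauchy_form F 0 \<mu>" by blast
    have "is_stieltjes_transform (\<lambda>t. LINT u:{0..}|\<mu>. 1 / (t + u)) \<mu>"
      unfolding is_stieltjes_transform_def by (rule exI[of _ 0]) simp
    with \<mu> cauchy_form_imp_stieltjes_extension[OF \<mu> form]
    show "\<exists>g h. continuous_extension_to_pos (G_fun F) g h \<and>
        (\<exists>\<mu>. finite_measure_on {0..} \<mu> \<and> is_stieltjes_transform h \<mu>)" by blast
  next
    assume "\<exists>g h. continuous_extension_to_pos (G_fun F) g h \<and>
        (\<exists>\<mu>. finite_measure_on {0..} \<mu> \<and> is_stieltjes_transform h \<mu>)"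
    then obtain g h \<mu> d where ext: "continuous_extension_to_pos (G_fun F) g h"
      and \<mu>: "finite_measure_on {0..} \<mu>"
      and h: "\<And>t. 0 < t \<Longrightarrow> h t = d + (LINT u:{0..}|\<mu>. 1 / (t + u))"
      unfolding is_stieltjes_transform_def by blast
    have form: "cauchy_form F d \<mu>"
      by (rule stieltjes_extension_imp_cauchy_form[OF hol ext \<mu> h])
    with \<mu> cauchy_form_constant_eq_0[OF fbm[OF \<mu>] form assms(3)]
    show "\<exists>\<mu>. finite_measure_on {0..} \<mu> \<and> cauchy_form F 0 \<mu>" by blast
  qed
qed

end
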